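(* Let $q$ be a prime power and $c\in\mathbb F_{q^2}\setminus\mathbb F_q$. Let $L=DS(\mathbb F_{q^2},c)$ be the quasigroup on $\mathbb F_{q^2}$ with multiplication $x*y=x+(y-x)c$. Then $L$ is a division sudoku of rank $q$ satisfying $\sigma(L)\ge q+1$. In particular, $\sigma(q)\ge q+1$.
   Context: $\mathbb F_q$ is the field of order $q$, regarded as a subfield of $\mathbb F_{q^2}$. A quasigroup on a finite set $X$ is identified with its multiplication table, a latin square $L$ on $X$ (array with $L(x,y)=x*y$ whose every row and column contains all symbols). For $c\in\mathbb F_{q^2}\setminus\{0,1\}$, $(\mathbb F_{q^2},* )$ is indeed a quasigroup. Let $|X|=m^2$. A sudoku partition of $X$ is a partition $\{X_1,\dots,X_m\}$ of $X$ into $m$ blocks of size $m$. With $O(L)=\{(x,y,L(x,y)):x,y\in X\}$, the bands, stacks and piles of $L$ are $B_i=\{(x,y,z)\in O(L):x\in X_i\}$, $S_i=\{(x,y,z)\in O(L):y\in X_i\}$, $P_i=\{(x,y,z)\in O(L):z\in X_i\}$. $L$ is a division sudoku of rank $m$ with respect to the sudoku partition if for all $i,j$: every $z\in X$ occurs as a third coordinate in $B_i\cap S_j$, every $y\in X$ occurs as a second coordinate in $B_i\cap P_j$, and every $x\in X$ occurs as a first coordinate in $S_i\cap P_j$. $\sigma(L)$ is the number of sudoku partitions of $X$ with respect to which $L$ is a division sudoku. For $m\ge 2$, $\sigma(m)=\max\{\sigma(L): L \text{ is a division sudoku of rank } m\}$, the maximum over latin squares of order $m^2$ that are division sudokus with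 respect to at least one sudoku partition. *)

theory Defs
  imports
    "HOL-Library.Disjoint_Sets"
    "HOL-Number_Theory.Prime_Powers"
    "HOL-Algebra.Subrings"
begin

text \<open>
  A latin square on a finite set \<open>X\<close> is a binary operation of which only the
  values on \<open>X \<times> X\<close> matter.
\<close>

definition latin_square :: "'a set \<Rightarrow> ('a \<Rightarrow> 'a \<Rightarrow> 'a) \<Rightarrow> bool" where
  "latin_square X L \<longleftrightarrow>
     finite X \<and> (\<forall>x\<in>X. (\<lambda>y. L x y) ` X = X) \<and> (\<forall>y\<in>X. (\<lambda>x. L x y) ` X = X)"

definition triples :: "'a set \<Rightarrow> ('a \<Rightarrow> 'a \<Rightarrow> 'a) \<Rightarrow> ('a \<times> 'a \<times> 'a) set" where
  "triples X L = {(x, y, L x y) | x y. x \<in> X \<and> y \<in> X}"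

definition band :: "'a set \<Rightarrow> ('a \<Rightarrow> 'a \<Rightarrow> 'a) \<Rightarrow> 'a set \<Rightarrow> ('a \<times> 'a \<times> 'a) set" where
  "band X L A = {(x, y, z). (x, y, z) \<in> triples X L \<and> x \<in> A}"

definition stack :: "'a set \<Rightarrow> ('a \<Rightarrow> 'a \<Rightarrow> 'a) \<Rightarrow> 'a set \<Rightarrow> ('a \<times> 'a \<times> 'a) set" where
  "stack X L A = {(x, y, z). (x, y, z) \<in> triples X L \<and> y \<in> A}"

definition pile :: "'a set \<Rightarrow> ('a \<Rightarrow> 'a \<Rightarrow> 'a) \<Rightarrow> 'a set \<Rightarrow> ('a \<times> 'a \<times> 'a) set" where
  "pile X L A = {(x, y, z). (x, y, z) \<in> triples X L \<and> z \<in> A}"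

text \<open>
  Sudoku partitions are unordered: a partition is the set of its blocks, so that
  relabelling the blocks does not produce a new partition.
\<close>

definition sudoku_partition :: "nat \<Rightarrow> 'a set \<Rightarrow> 'a set set \<Rightarrow> bool" where
  "sudoku_partition m X P \<longleftrightarrow>
     card X = m^2 \<and> partition_on X P \<and> card P = m \<and> (\<forall>A\<in>P. card A = m)"

definition division_sudoku_wrt ::
    "nat \<Rightarrow> 'a set \<Rightarrow> ('a \<Rightarrow> 'a \<Rightarrow> 'a) \<Rightarrow> 'a set set \<Rightarrow> bool" where
  "division_sudoku_wrt m X L P \<longleftrightarrow>
     latin_square X L \<and> sudoku_partition m X P \<and>
     (\<forall>A\<in>P. \<forall>B\<in>P.
        (\<forall>z\<in>X. \<exists>x y. (x, y, z) \<in> band X L A \<inter> stack X L B) \<and>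
        (\<forall>y\<in>X. \<exists>x z. (x, y, z) \<in> band X L A \<inter> pile X L B) \<and>
        (\<forall>x\<in>X. \<exists>y z. (x, y, z) \<in> stack X L A \<inter> pile X L B))"

definition division_sudoku :: "nat \<Rightarrow> 'a set \<Rightarrow> ('a \<Rightarrow> 'a \<Rightarrow> 'a) \<Rightarrow> bool" where
  "division_sudoku m X L \<longleftrightarrow> (\<exists>P. division_sudoku_wrt m X L P)"

text \<open>The rank \<open>m\<close> is determined by \<open>card X = m\<^sup>2\<close>, but is kept as an explicit argument.\<close>

definition sigma :: "nat \<Rightarrow> 'a set \<Rightarrow> ('a \<Rightarrow> 'a \<Rightarrow> 'a) \<Rightarrow> nat" where
  "sigma m X L = card {P. division_sudoku_wrt m X L P}"

text \<open>
  The number \<open>sigma m X L\<close> is invariant under renaming the elements of \<open>X\<close>, so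
  for the maximum over all latin squares of order \<open>m\<^sup>2\<close> it suffices to consider
  finite sets \<open>X\<close> of natural numbers.  The set of values is finite, as there are
  only finitely many partitions of a set with \<open>m\<^sup>2\<close> elements.
\<close>

definition sigma_max :: "nat \<Rightarrow> nat" where
  "sigma_max m = Max {sigma m X L | (X :: nat set) L. division_sudoku m X L}"

definition DS :: "('a, 'b) ring_scheme \<Rightarrow> 'a \<Rightarrow> 'a \<Rightarrow> 'a \<Rightarrow> 'a" where
  "DS F c x y = x \<oplus>\<^bsub>F\<^esub> (y \<ominus>\<^bsub>F\<^esub> x) \<otimes>\<^bsub>F\<^esub> c"

end

theory Submission
  imports Defs "HOL-Algebra.Algebraic_Closure" "HOL-Number_Theory.Residues"
begin

text \<open>
  The field \<open>F\<close> with \<open>q\<^sup>2\<close> elements is an affine plane over its subfield \<open>K\<close>. A direction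
  in this plane, that is, a line \<open>K \<otimes> t\<close> through the origin, partitions \<open>F\<close> into \<open>q\<close> parallel
  lines of size \<open>q\<close>, and each of the \<open>q + 1\<close> directions gives a sudoku partition for
  \<open>x * y = x \<oplus> (y \<ominus> x) \<otimes> c\<close>. The product is linear over \<open>F\<close> in the pair \<open>(x, y)\<close>, so each
  of the three sudoku conditions asks whether every element of \<open>F\<close> is a sum of elements of two
  lines: those spanned by \<open>(\<one> \<ominus> c) \<otimes> t\<close> and \<open>c \<otimes> t\<close>, by \<open>(\<one> \<ominus> c) \<otimes> t\<close> and \<open>t\<close>, and
  by \<open>c \<otimes> t\<close> and \<open>t\<close>. In each case the two generators form a basis of \<open>F\<close> over \<open>K\<close>, because
  \<open>c\<close> is not in \<open>K\<close> (\<open>span_scaled\<close>, \<open>division_sudoku_parallel_class\<close>). The number of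
  directions comes from counting nonzero elements (\<open>card_lines\<close>), and a direction is determined
  by its partition (\<open>inj_on_parallel_class\<close>).

  For the bound on \<open>sigma_max\<close> a suitable field must exist for every prime power \<open>q = p ^ k\<close>.
  It is found inside an algebraic closure of the prime field, as the set of roots of
  \<open>X [^] (q\<^sup>2) \<ominus> X\<close>. This set is a field because the Frobenius map is additive
  (\<open>frobenius_fixed_subfield\<close>), and it has \<open>q\<^sup>2\<close> elements because all roots are simple
  (\<open>card_frobenius_fixed\<close>); the roots of \<open>X [^] q \<ominus> X\<close> form the subfield. The resulting latin
  square is then transported to a set of natural numbers (\<open>sigma_le_sigma_max\<close>).
\<close>

section \<open>Sudoku partitions and their transport along injections\<close>

lemma mem_triples_iff [simp]: "(x, y, z) \<in> triples V L \<longleftrightarrow> x \<in> V \<and> y \<in> V \<and> z = L x y"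
  by (auto simp: triples_def)

lemma mem_band_stack_pile_iff [simp]:
  "(x, y, z) \<in> band V L A \<longleftrightarrow> x \<in> V \<and> y \<in> V \<and> z = L x y \<and> x \<in> A"
  "(x, y, z) \<in> stack V L A \<longleftrightarrow> x \<in> V \<and> y \<in> V \<and> z = L x y \<and> y \<in> A"
  "(x, y, z) \<in> pile V L A \<longleftrightarrow> x \<in> V \<and> y \<in> V \<and> z = L x y \<and> z \<in> A"
  by (auto simp: band_def stack_def pile_def)

lemma division_sudoku_wrt_subset_Pow:
  "{P. division_sudoku_wrt m V L P} \<subseteq> Pow (Pow V)"
  by (auto simp: division_sudoku_wrt_def sudoku_partition_def partition_on_def)

lemma finite_division_sudoku_wrt:
  assumes "finite V" shows "finite {P. division_sudoku_wrt m V L P}"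
  by (rule finite_subset[OF division_sudoku_wrt_subset_Pow]) (simp add: assms)

text \<open>
  The bound depends on \<open>m\<close> only; it makes the set of values over which \<open>sigma_max m\<close>
  is taken finite, so that its maximum is attained.
\<close>
lemma sigma_le:
  assumes "division_sudoku m V L" shows "sigma m V L \<le> 2 ^ (2 ^ (m\<^sup>2))"
proof -
  from assms have V: "finite V" "card V = m\<^sup>2"
    by (auto simp: division_sudoku_def division_sudoku_wrt_def latin_square_def sudoku_partition_def)
  have "sigma m V L \<le> card (Pow (Pow V))"
    unfolding sigma_def by (rule card_mono[OF _ division_sudoku_wrt_subset_Pow]) (simp add: V)
  then show ?thesis using V by (simp add: card_Pow)
qed

lemma sigma_nat_le_sigma_max:
  fixes V :: "nat set"
  assumes "division_sudoku m V L" shows "sigma m V L \<le> sigma_max m"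
  unfolding sigma_max_def
proof (rule Max_ge)
  show "finite {sigma m V L | (V :: nat set) L. division_sudoku m V L}"
    by (rule finite_subset[of _ "{..2 ^ (2 ^ (m\<^sup>2))}"]) (use sigma_le in auto)
qed (use assms in auto)

text \<open>
  The operation on \<open>f ` V\<close> that makes \<open>f\<close> an isomorphism from \<open>L\<close>.
\<close>
definition transport :: "('a \<Rightarrow> 'b) \<Rightarrow> 'a set \<Rightarrow> ('a \<Rightarrow> 'a \<Rightarrow> 'a) \<Rightarrow> 'b \<Rightarrow> 'b \<Rightarrow> 'b" where
  "transport f V L x y = f (L (inv_into V f x) (inv_into V f y))"

lemma division_sudoku_wrt_transport:
  assumes f: "inj_on f V" and D: "division_sudoku_wrt m V L P"
  shows "division_sudoku_wrt m (f ` V) (transport f V L) ((`) f ` P)"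
proof -
  let ?L = "transport f V L"
  have L: "latin_square V L" and P: "sudoku_partition m V P"
    and part: "partition_on V P"
    using D by (auto simp: division_sudoku_wrt_def sudoku_partition_def)
  have op: "?L (f x) (f y) = f (L x y)" if "x \<in> V" "y \<in> V" for x y
    using that f by (simp add: transport_def)
  have sub: "A \<subseteq> V" if "A \<in> P" for A
    using that part by (auto simp: partition_on_def)
  have "latin_square (f ` V) ?L"
  proof -
    have "(\<lambda>y. ?L (f x) y) ` f ` V = f ` V" if "x \<in> V" for x
    proof -
      have "(\<lambda>y. ?L (f x) y) ` f ` V = f ` (\<lambda>y. L x y) ` V"
        using that op by (auto simp: image_image)
      also have "\<dots> = f ` V" using L that by (simp add: latin_square_def)
      finally show ?thesis .
    qed
    moreover have "(\<lambda>x. ?L x (f y)) ` f ` V = f ` V" if "y \<in> V" for y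
    proof -
      have "(\<lambda>x. ?L x (f y)) ` f ` V = f ` (\<lambda>x. L x y) ` V"
        using that op by (auto simp: image_image)
      also have "\<dots> = f ` V" using L that by (simp add: latin_square_def)
      finally show ?thesis .
    qed
    ultimately show ?thesis using L by (auto simp: latin_square_def)
  qed
  moreover have "sudoku_partition m (f ` V) ((`) f ` P)"
  proof -
    have "partition_on (f ` V) ((`) f ` P)"
    proof (rule partition_onI)
      fix A B assume "A \<in> (`) f ` P" "B \<in> (`) f ` P" "A \<noteq> B"
      then obtain A' B' where "A' \<in> P" "B' \<in> P" "A' \<noteq> B'" "A = f ` A'" "B = f ` B'" by auto
      then show "disjnt A B"
        using part sub inj_on_image_Int[OF f, of A' B']
        by (auto simp: partition_on_def disjoint_def disjnt_def)
    qed (use part in \<open>auto simp: partition_on_def\<close>)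
    moreover have "inj_on ((`) f) P"
      using inj_on_image_Pow[OF f] sub by (auto intro: inj_on_subset)
    moreover have "card (f ` A) = m" if "A \<in> P" for A
      using that P sub[OF that] f inj_on_subset
      by (metis card_image sudoku_partition_def)
    ultimately show ?thesis
      using P f by (auto simp: sudoku_partition_def card_image)
  qed
  moreover have "\<forall>A\<in>(`) f ` P. \<forall>B\<in>(`) f ` P.
        (\<forall>z\<in>f ` V. \<exists>x y. (x, y, z) \<in> band (f ` V) ?L A \<inter> stack (f ` V) ?L B) \<and>
        (\<forall>y\<in>f ` V. \<exists>x z. (x, y, z) \<in> band (f ` V) ?L A \<inter> pile (f ` V) ?L B) \<and>
        (\<forall>x\<in>f ` V. \<exists>y z. (x, y, z) \<in> stack (f ` V) ?L A \<inter> pile (f ` V) ?L B)"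
  proof -
    have band: "(f x, f y, f z) \<in> band (f ` V) ?L (f ` A)" if "(x, y, z) \<in> band V L A" for x y z A
      using that op by auto
    have stack: "(f x, f y, f z) \<in> stack (f ` V) ?L (f ` A)" if "(x, y, z) \<in> stack V L A" for x y z A
      using that op by auto
    have pile: "(f x, f y, f z) \<in> pile (f ` V) ?L (f ` A)" if "(x, y, z) \<in> pile V L A" for x y z A
      using that op by auto
    have D': "\<forall>A\<in>P. \<forall>B\<in>P.
        (\<forall>z\<in>V. \<exists>x y. (x, y, z) \<in> band V L A \<inter> stack V L B) \<and>
        (\<forall>y\<in>V. \<exists>x z. (x, y, z) \<in> band V L A \<inter> pile V L B) \<and>
        (\<forall>x\<in>V. \<exists>y z. (x, y, z) \<in> stack V L A \<inter> pile V L B)"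
      using D unfolding division_sudoku_wrt_def by (elim conjE)
    show ?thesis
    proof (intro ballI conjI; elim imageE; hypsubst)
      fix A B z assume "A \<in> P" "B \<in> P" "z \<in> V"
      then obtain x y where "(x, y, z) \<in> band V L A \<inter> stack V L B" using D' by meson
      then show "\<exists>x y. (x, y, f z) \<in> band (f ` V) ?L (f ` A) \<inter> stack (f ` V) ?L (f ` B)"
        using band stack by blast
    next
      fix A B y assume "A \<in> P" "B \<in> P" "y \<in> V"
      then obtain x z where "(x, y, z) \<in> band V L A \<inter> pile V L B" using D' by meson
      then show "\<exists>x z. (x, f y, z) \<in> band (f ` V) ?L (f ` A) \<inter> pile (f ` V) ?L (f ` B)"
        using band pile by blast
    next
      fix A B x assume "A \<in> P" "B \<in> P" "x \<in> V"
      then obtain y z where "(x, y, z) \<in> stack V L A \<inter> pile V L B" using D' by meson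
      then show "\<exists>y z. (f x, y, z) \<in> stack (f ` V) ?L (f ` A) \<inter> pile (f ` V) ?L (f ` B)"
        using stack pile by blast
    qed
  qed
  ultimately show ?thesis by (simp only: division_sudoku_wrt_def)
qed

text \<open>
  The maximum \<open>sigma_max m\<close> is taken over sets of natural numbers. A finite set of any type
  injects into the natural numbers, and transporting along the injection sends different
  sudoku partitions to different ones.
\<close>
lemma sigma_le_sigma_max:
  fixes V :: "'a set"
  assumes D: "division_sudoku m V L" shows "sigma m V L \<le> sigma_max m"
proof -
  have fin: "finite V" using D by (auto simp: division_sudoku_def division_sudoku_wrt_def latin_square_def)
  then obtain f :: "'a \<Rightarrow> nat" where f: "inj_on f V"
    using finite_imp_inj_to_nat_seg by blast
  let ?Y = "f ` V" let ?L = "transport f V L"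
  have "inj_on ((`) ((`) f)) {P. division_sudoku_wrt m V L P}"
    by (rule inj_on_subset[OF inj_on_image_Pow[OF inj_on_image_Pow[OF f]]
          division_sudoku_wrt_subset_Pow])
  then have "sigma m V L \<le> sigma m ?Y ?L"
    unfolding sigma_def
    by (rule card_inj_on_le) (use finite_division_sudoku_wrt[of "f ` V"] fin division_sudoku_wrt_transport[OF f] in auto)
  also have "\<dots> \<le> sigma_max m"
    by (rule sigma_nat_le_sigma_max)
      (use D division_sudoku_wrt_transport[OF f] in \<open>auto simp: division_sudoku_def\<close>)
  finally show ?thesis .
qed

section \<open>Parallel classes of lines as sudoku partitions\<close>

text \<open>
  The size of the finite field \<open>F\<close> says that it has dimension two over \<open>K\<close>. An element
  \<open>c\<close> outside \<open>K\<close> then completes \<open>\<one>\<close> to a basis.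
\<close>
locale quadratic_extension = field F + subfield K F for F (structure) and K +
  fixes c
  assumes finite_carrier: "finite (carrier F)"
    and card_carrier: "card (carrier F) = (card K)\<^sup>2"
    and c_carrier: "c \<in> carrier F" and c_notin: "c \<notin> K"
begin

lemmas K_simps [simp] = subringE(2,3,5,6,7)[OF subfieldE(1)[OF subfield_axioms]]

lemma K_minus [simp]: "a \<in> K \<Longrightarrow> b \<in> K \<Longrightarrow> a \<ominus> b \<in> K"
  by (simp add: a_minus_def K_simps)

lemma K_carrier [simp]: "k \<in> K \<Longrightarrow> k \<in> carrier F"
  using subfieldE(3)[OF subfield_axioms] by auto

lemma K_inv: "k \<in> K \<Longrightarrow> k \<noteq> \<zero> \<Longrightarrow> inv k \<in> K"
  using subfield_m_inv(1)[OF subfield_axioms, of k] by auto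

lemma finite_K: "finite K"
  by (rule finite_subset[OF _ finite_carrier]) auto

lemma card_K: "card K \<ge> 2"
proof -
  have "card {\<zero>, \<one>} \<le> card K"
    by (rule card_mono) (use finite_K K_simps in auto)
  then show ?thesis by simp
qed

declare c_carrier [simp]

lemma cancel_inv: "a \<in> carrier F \<Longrightarrow> a \<noteq> \<zero> \<Longrightarrow> b \<in> carrier F \<Longrightarrow> b \<otimes> inv a \<otimes> a = b"
  by (metis field_Units Diff_iff Units_inv_closed Units_l_inv m_assoc r_one singletonD)

lemma inv_carrier: "a \<in> carrier F \<Longrightarrow> a \<noteq> \<zero> \<Longrightarrow> inv a \<in> carrier F"
  by (simp add: field_Units)

text \<open>
  If \<open>u \<oplus> v \<otimes> c = u' \<oplus> v' \<otimes> c\<close> with \<open>v \<noteq> v'\<close>, then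
  \<open>c = (u' \<ominus> u) / (v \<ominus> v')\<close> would lie in \<open>K\<close>. So the map from \<open>K \<times> K\<close> to \<open>F\<close> is
  injective, and surjective because both sides have the same size.
\<close>
lemma span_one_c:
  assumes "z \<in> carrier F"
  obtains u v where "u \<in> K" "v \<in> K" "z = u \<oplus> v \<otimes> c"
proof -
  let ?h = "\<lambda>(u, v). u \<oplus> v \<otimes> c"
  have inj: "inj_on ?h (K \<times> K)"
  proof (rule inj_onI, clarify)
    fix u v u' v' assume K: "u \<in> K" "v \<in> K" "u' \<in> K" "v' \<in> K"
      and eq: "u \<oplus> v \<otimes> c = u' \<oplus> v' \<otimes> c"
    have C [simp]: "u \<in> carrier F" "v \<in> carrier F" "u' \<in> carrier F" "v' \<in> carrier F"
      using K by auto
    have "(v \<ominus> v') \<otimes> c = (u \<oplus> v \<otimes> c) \<ominus> v' \<otimes> c \<ominus> u"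
      using C c_carrier by algebra
    also have "\<dots> = u' \<ominus> u" unfolding eq using C c_carrier by algebra
    finally have c: "(v \<ominus> v') \<otimes> c = u' \<ominus> u" .
    have v: "v = v'"
    proof (rule ccontr)
      assume "v \<noteq> v'"
      then have nz: "v \<ominus> v' \<noteq> \<zero>" by simp
      have "c = inv (v \<ominus> v') \<otimes> (u' \<ominus> u)"
        using nz c by (metis K K_carrier K_minus c_carrier inv_carrier cancel_inv m_comm m_assoc)
      then show False using c_notin nz K by (metis K_inv K_minus K_simps(4))
    qed
    then show "u = u' \<and> v = v'" using eq by simp
  qed
  have "?h ` (K \<times> K) = carrier F"
  proof (rule card_subset_eq[OF finite_carrier])
    show "card (?h ` (K \<times> K)) = card (carrier F)"
      using card_image[OF inj] card_carrier by (simp add: card_cartesian_product power2_eq_square)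
  qed auto
  then have "z \<in> ?h ` (K \<times> K)" using assms by simp
  then show ?thesis using that by auto
qed

text \<open>
  Geometrically, the lines spanned by \<open>t\<close> and \<open>t \<otimes> c\<close> are complementary. All three
  sudoku conditions for the direction \<open>t\<close> reduce to this.
\<close>
lemma span_scaled:
  assumes t: "t \<in> carrier F" "t \<noteq> \<zero>" and z: "z \<in> carrier F"
  obtains u v where "u \<in> K" "v \<in> K" "z = u \<otimes> t \<oplus> v \<otimes> t \<otimes> c"
proof -
  have "z \<otimes> inv t \<in> carrier F" using t z inv_carrier by simp
  then obtain u v where uv: "u \<in> K" "v \<in> K" "z \<otimes> inv t = u \<oplus> v \<otimes> c" by (rule span_one_c)
  have "z = z \<otimes> inv t \<otimes> t" using t z cancel_inv by simp
  also have "\<dots> = (u \<oplus> v \<otimes> c) \<otimes> t" by (simp only: uv(3))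
  also have "\<dots> = u \<otimes> t \<oplus> v \<otimes> t \<otimes> c" using uv(1,2)[THEN K_carrier] t(1) c_carrier by algebra
  finally show ?thesis using that uv by blast
qed

lemma DS_closed [simp]: "x \<in> carrier F \<Longrightarrow> y \<in> carrier F \<Longrightarrow> DS F c x y \<in> carrier F"
  by (simp add: DS_def)

text \<open>
  The product \<open>x \<oplus> (y \<ominus> x) \<otimes> c\<close> is affine in \<open>y\<close> with slope \<open>c\<close> and affine in \<open>x\<close> with
  slope \<open>\<one> \<ominus> c\<close>, and neither slope vanishes because \<open>\<zero>\<close> and \<open>\<one>\<close> lie in \<open>K\<close>.
\<close>
lemma latin_square_DS: "latin_square (carrier F) (DS F c)"
proof -
  have c0: "c \<noteq> \<zero>" and c1: "\<one> \<ominus> c \<noteq> \<zero>"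
    using c_notin K_simps by auto
  have rows: "z \<in> DS F c x ` carrier F" if [simp]: "x \<in> carrier F" "z \<in> carrier F" for x z
  proof
    let ?d = "(z \<ominus> x) \<otimes> inv c"
    have [simp]: "?d \<in> carrier F" using c0 inv_carrier by simp
    show "x \<oplus> ?d \<in> carrier F" by simp
    have gen: "DS F c x (x \<oplus> d) = x \<oplus> d \<otimes> c" if "d \<in> carrier F" for d
      unfolding DS_def using that \<open>x \<in> carrier F\<close> c_carrier by algebra
    have "DS F c x (x \<oplus> ?d) = x \<oplus> ?d \<otimes> c" by (rule gen) simp
    also have "?d \<otimes> c = z \<ominus> x" using c0 cancel_inv by simp
    also have "x \<oplus> (z \<ominus> x) = z" using that by algebra
    finally show "z = DS F c x (x \<oplus> ?d)" by simp
  qed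
  have cols: "z \<in> (\<lambda>x. DS F c x y) ` carrier F" if [simp]: "y \<in> carrier F" "z \<in> carrier F" for y z
  proof
    let ?d = "(z \<ominus> y) \<otimes> inv (\<one> \<ominus> c)"
    have [simp]: "?d \<in> carrier F" using c1 inv_carrier by simp
    show "y \<oplus> ?d \<in> carrier F" by simp
    have gen: "DS F c (y \<oplus> d) y = y \<oplus> d \<otimes> (\<one> \<ominus> c)" if "d \<in> carrier F" for d
      unfolding DS_def using that \<open>y \<in> carrier F\<close> c_carrier by algebra
    have "DS F c (y \<oplus> ?d) y = y \<oplus> ?d \<otimes> (\<one> \<ominus> c)" by (rule gen) simp
    also have "?d \<otimes> (\<one> \<ominus> c) = z \<ominus> y" using c1 by (intro cancel_inv) auto
    also have "y \<oplus> (z \<ominus> y) = z" using that by algebra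
    finally show "z = DS F c (y \<oplus> ?d) y" by simp
  qed
  show ?thesis unfolding latin_square_def using finite_carrier rows cols by auto
qed

definition line :: "'a \<Rightarrow> 'a set" where "line t = (\<lambda>k. k \<otimes> t) ` K"

lemma line_subgroup:
  assumes [simp]: "t \<in> carrier F" shows "subgroup (line t) (add_monoid F)"
proof (rule add.subgroupI)
  show "line t \<noteq> {}" using K_simps(1) by (auto simp: line_def simp del: K_simps)
  show "\<And>a. a \<in> line t \<Longrightarrow> \<ominus> a \<in> line t"
    using K_simps by (auto simp: line_def simp flip: l_minus)
  show "\<And>a b. a \<in> line t \<Longrightarrow> b \<in> line t \<Longrightarrow> a \<oplus> b \<in> line t"
    using K_simps by (auto simp: line_def simp flip: l_distr)
qed (auto simp: line_def)

lemma card_line: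
  assumes "t \<in> carrier F" "t \<noteq> \<zero>" shows "card (line t) = card K"
  unfolding line_def by (rule card_image) (use assms m_rcancel in \<open>auto intro!: inj_onI\<close>)

text \<open>
  For a line \<open>U\<close> through the origin, this is the set of all affine lines parallel to \<open>U\<close>.
\<close>
definition parallel_class :: "'a set \<Rightarrow> 'a set set" where "parallel_class U = a_rcosets U"

lemma block_cases:
  assumes "t \<in> carrier F" "A \<in> parallel_class (line t)"
  obtains a where "a \<in> carrier F" "A = {a \<oplus> k \<otimes> t |k. k \<in> K}"
proof -
  obtain a where a: "a \<in> carrier F" "A = line t +> a"
    using assms(2) by (auto simp: parallel_class_def A_RCOSETS_defs a_r_coset_def r_coset_def)
  have "k \<otimes> t \<oplus> a = a \<oplus> k \<otimes> t" if "k \<in> K" for k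
    using that a assms(1) by (simp add: a_comm)
  then have "A = {a \<oplus> k \<otimes> t |k. k \<in> K}"
    unfolding a(2) line_def a_r_coset_def' by auto
  then show ?thesis using that a(1) by blast
qed

lemma sudoku_partition_parallel_class:
  assumes t: "t \<in> carrier F" "t \<noteq> \<zero>"
  shows "sudoku_partition (card K) (carrier F) (parallel_class (line t))"
proof -
  note H = line_subgroup[OF t(1)]
  have sub: "line t \<subseteq> carrier F" using t by (auto simp: line_def)
  have cards: "card A = card K" if "A \<in> parallel_class (line t)" for A
    using that add.card_rcosets_equal[of A "line t"] sub card_line[OF t]
    by (simp add: parallel_class_def A_RCOSETS_def)
  have "card (parallel_class (line t)) * card K = (card K)\<^sup>2"
    using add.lagrange[OF H] card_line[OF t] card_carrier
    by (simp add: parallel_class_def A_RCOSETS_def order_def)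
  then have "card (parallel_class (line t)) = card K"
    using card_K by (simp add: power2_eq_square)
  moreover have "partition_on (carrier F) (parallel_class (line t))"
    using add.rcosets_part_G[OF H] add.rcos_disjoint[OF H] cards card_K
    by (fastforce simp: partition_on_def parallel_class_def A_RCOSETS_def)
  ultimately show ?thesis using cards card_carrier by (simp add: sudoku_partition_def)
qed

text \<open>
  Let two of the three coordinates range over the affine lines \<open>a \<oplus> K \<otimes> t\<close> and
  \<open>b \<oplus> K \<otimes> t\<close>, and prescribe the third. Because \<open>DS F c\<close> is additive in its pair of
  arguments, the equation between the coordinates becomes, after collecting the constant
  terms on one side, a representation of an element of \<open>F\<close> as \<open>u \<otimes> t \<oplus> v \<otimes> t \<otimes> c\<close> with
  \<open>u\<close> and \<open>v\<close> in \<open>K\<close>, up to an invertible change of the coefficients over \<open>K\<close>. Such a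
  representation always exists.
\<close>
lemma division_sudoku_parallel_class:
  assumes t: "t \<in> carrier F" "t \<noteq> \<zero>"
  shows "division_sudoku_wrt (card K) (carrier F) (DS F c) (parallel_class (line t))"
  unfolding division_sudoku_wrt_def
proof (intro conjI ballI latin_square_DS sudoku_partition_parallel_class[OF t])
  note [simp] = t(1)
  fix A B assume AB: "A \<in> parallel_class (line t)" "B \<in> parallel_class (line t)"
  obtain a where a [simp]: "a \<in> carrier F" and A: "A = {a \<oplus> k \<otimes> t |k. k \<in> K}"
    by (rule block_cases[OF t(1) AB(1)])
  obtain b where b [simp]: "b \<in> carrier F" and B: "B = {b \<oplus> k \<otimes> t |k. k \<in> K}"
    by (rule block_cases[OF t(1) AB(2)])
  {
    fix z assume z [simp]: "z \<in> carrier F"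
    obtain u v where uv: "u \<in> K" "v \<in> K" and w: "z \<ominus> DS F c a b = u \<otimes> t \<oplus> v \<otimes> t \<otimes> c"
      by (rule span_scaled[OF t, of "z \<ominus> DS F c a b"]) auto
    note C = uv[THEN K_carrier] a b t(1) c_carrier z
    note [simp] = uv
    \<comment> \<open>Moving \<open>x\<close> by \<open>u \<otimes> t\<close> and \<open>y\<close> by \<open>v' \<otimes> t\<close> moves the product by \<open>u \<otimes> t \<oplus> (v' \<ominus> u) \<otimes> t \<otimes> c\<close>.\<close>
    have "DS F c (a \<oplus> u \<otimes> t) (b \<oplus> (v \<oplus> u) \<otimes> t) = DS F c a b \<oplus> (u \<otimes> t \<oplus> v \<otimes> t \<otimes> c)"
      unfolding DS_def using C by algebra
    also have "\<dots> = z" unfolding w[symmetric] DS_def using C by algebra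
    finally have "z = DS F c (a \<oplus> u \<otimes> t) (b \<oplus> (v \<oplus> u) \<otimes> t)" by simp
    moreover have "a \<oplus> u \<otimes> t \<in> A" "b \<oplus> (v \<oplus> u) \<otimes> t \<in> B"
      unfolding A B using uv K_simps(5) by blast+
    ultimately show "\<exists>x y. (x, y, z) \<in> band (carrier F) (DS F c) A \<inter> stack (carrier F) (DS F c) B"
      by (intro exI[of _ "a \<oplus> u \<otimes> t"] exI[of _ "b \<oplus> (v \<oplus> u) \<otimes> t"]) simp
  next
    fix y assume y [simp]: "y \<in> carrier F"
    obtain u v where uv: "u \<in> K" "v \<in> K" and w: "b \<ominus> DS F c a y = u \<otimes> t \<oplus> v \<otimes> t \<otimes> c"
      by (rule span_scaled[OF t, of "b \<ominus> DS F c a y"]) auto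
    note C = uv[THEN K_carrier] a b t(1) c_carrier y
    note [simp] = uv
    \<comment> \<open>The coefficient of \<open>c\<close> fixes the position of \<open>x\<close>; the rest is absorbed by the block of \<open>z\<close>.\<close>
    have "DS F c (a \<oplus> (\<ominus> v) \<otimes> t) y = DS F c a y \<oplus> (u \<otimes> t \<oplus> v \<otimes> t \<otimes> c) \<oplus> (\<ominus> v \<ominus> u) \<otimes> t"
      unfolding DS_def using C by algebra
    also have "\<dots> = b \<oplus> (\<ominus> v \<ominus> u) \<otimes> t" unfolding w[symmetric] DS_def using C by algebra
    finally have "DS F c (a \<oplus> (\<ominus> v) \<otimes> t) y \<in> B"
      unfolding B using uv K_simps(3) K_minus by blast
    moreover have "a \<oplus> (\<ominus> v) \<otimes> t \<in> A" unfolding A using uv K_simps(3) by blast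
    ultimately show "\<exists>x z. (x, y, z) \<in> band (carrier F) (DS F c) A \<inter> pile (carrier F) (DS F c) B"
      by (intro exI[of _ "a \<oplus> (\<ominus> v) \<otimes> t"] exI) simp
  next
    fix x assume x [simp]: "x \<in> carrier F"
    obtain u v where uv: "u \<in> K" "v \<in> K" and w: "b \<ominus> DS F c x a = u \<otimes> t \<oplus> v \<otimes> t \<otimes> c"
      by (rule span_scaled[OF t, of "b \<ominus> DS F c x a"]) auto
    note C = uv[THEN K_carrier] a b t(1) c_carrier x
    note [simp] = uv
    have "DS F c x (a \<oplus> v \<otimes> t) = DS F c x a \<oplus> (u \<otimes> t \<oplus> v \<otimes> t \<otimes> c) \<oplus> (\<ominus> u) \<otimes> t"
      unfolding DS_def using C by algebra
    also have "\<dots> = b \<oplus> (\<ominus> u) \<otimes> t" unfolding w[symmetric] DS_def using C by algebra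
    finally have "DS F c x (a \<oplus> v \<otimes> t) \<in> B"
      unfolding B using uv K_simps(3) by blast
    moreover have "a \<oplus> v \<otimes> t \<in> A" unfolding A using uv by blast
    ultimately show "\<exists>y z. (x, y, z) \<in> stack (carrier F) (DS F c) A \<inter> pile (carrier F) (DS F c) B"
      by (intro exI[of _ "a \<oplus> v \<otimes> t"] exI) simp
  }
qed

definition lines :: "'a set set" where "lines = line ` (carrier F - {\<zero>})"

text \<open>
  The lines through the origin cover the \<open>q\<^sup>2 - 1\<close> nonzero elements and each contains
  \<open>q - 1\<close> of them, where \<open>q = card K\<close>.
\<close>
lemma card_lines: "card lines \<ge> card K + 1"
proof -
  have fin: "finite lines" using finite_carrier by (simp add: lines_def)
  have "carrier F - {\<zero>} \<subseteq> (\<Union>U\<in>lines. U - {\<zero>})"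
  proof
    fix t assume t: "t \<in> carrier F - {\<zero>}"
    then have "t \<in> line t" unfolding line_def by (intro image_eqI[of _ _ \<one>]) (auto simp: K_simps)
    with t show "t \<in> (\<Union>U\<in>lines. U - {\<zero>})" by (auto simp: lines_def)
  qed
  then have "card (carrier F - {\<zero>}) \<le> card (\<Union>U\<in>lines. U - {\<zero>})"
    by (rule card_mono[rotated]) (use finite_carrier finite_K in \<open>auto simp: lines_def line_def\<close>)
  also have "\<dots> \<le> (\<Sum>U\<in>lines. card (U - {\<zero>}))" using fin by (rule card_UN_le)
  also have "\<dots> = (\<Sum>U\<in>lines. card K - 1)"
  proof (rule sum.cong[OF refl])
    fix U assume "U \<in> lines"
    then obtain t where t: "t \<in> carrier F" "t \<noteq> \<zero>" "U = line t" by (auto simp: lines_def)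
    moreover have "\<zero> \<in> U" unfolding t(3) line_def
      using t(1) K_simps(1) by (intro image_eqI[of _ _ \<zero>]) auto
    ultimately show "card (U - {\<zero>}) = card K - 1"
      using card_line[of t] finite_K by (simp add: card_Diff_singleton)
  qed
  finally have "(card K)\<^sup>2 - 1 \<le> card lines * (card K - 1)"
    using card_carrier finite_carrier by (simp add: card_Diff_singleton)
  moreover have "(card K)\<^sup>2 - 1 = (card K + 1) * (card K - 1)"
    by (simp add: power2_eq_square algebra_simps)
  ultimately have "(card K + 1) * (card K - 1) \<le> card lines * (card K - 1)" by (simp only:)
  then show ?thesis using card_K by (simp only: mult_le_cancel2)
qed

text \<open>
  A line through the origin is recovered from its parallel class as the block containing
  \<open>\<zero>\<close>.
\<close>
lemma inj_on_parallel_class: "inj_on parallel_class lines"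
proof (rule inj_on_inverseI[where g = "\<lambda>P. THE U. U \<in> P \<and> \<zero> \<in> U"])
  fix U assume "U \<in> lines"
  then obtain t where t: "t \<in> carrier F" "t \<noteq> \<zero>" "U = line t" by (auto simp: lines_def)
  have U: "U \<in> parallel_class U" 
    using subgroup.subgroup_in_rcosets[OF line_subgroup[OF t(1)] add.group_axioms] t(3)
    by (simp add: parallel_class_def A_RCOSETS_def)
  have 0: "\<zero> \<in> U" unfolding t(3) line_def
      using t(1) K_simps(1) by (intro image_eqI[of _ _ \<zero>]) auto
  show "(THE U'. U' \<in> parallel_class U \<and> \<zero> \<in> U') = U"
  proof (rule the_equality)
    fix U' assume "U' \<in> parallel_class U \<and> \<zero> \<in> U'"
    then show "U' = U" using U 0 sudoku_partition_parallel_class[OF t(1,2)] t(3)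
      by (auto simp: sudoku_partition_def partition_on_def disjoint_def)
  qed (use U 0 in auto)
qed

lemma division_sudoku_DS: "division_sudoku (card K) (carrier F) (DS F c)"
  unfolding division_sudoku_def by (intro exI, rule division_sudoku_parallel_class[of \<one>]) simp_all

lemma sigma_DS: "sigma (card K) (carrier F) (DS F c) \<ge> card K + 1"
proof -
  have "card lines \<le> sigma (card K) (carrier F) (DS F c)"
    unfolding sigma_def
    by (rule card_inj_on_le[OF inj_on_parallel_class])
      (use division_sudoku_parallel_class finite_division_sudoku_wrt[OF finite_carrier] in \<open>auto simp: lines_def\<close>)
  then show ?thesis using card_lines by simp
qed

end

lemma division_sudoku_DS_of_order:
  assumes "primepow q" "field F" "order F = q\<^sup>2" "subfield K F" "card K = q" "c \<in> carrier F - K"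
  shows "division_sudoku q (carrier F) (DS F c)" and "sigma q (carrier F) (DS F c) \<ge> q + 1"
proof -
  have "q > 0" using primepow_gt_Suc_0[OF assms(1)] by simp
  then have "finite (carrier F)"
    using assms(3) by (intro card_ge_0_finite) (simp add: order_def)
  then interpret quadratic_extension F K c
    using assms by (intro quadratic_extension.intro quadratic_extension_axioms.intro)
      (auto simp: order_def)
  show "division_sudoku q (carrier F) (DS F c)" "sigma q (carrier F) (DS F c) \<ge> q + 1"
    using division_sudoku_DS sigma_DS assms(5) by simp_all
qed

section \<open>Finite fields of prime power order\<close>

text \<open>
  Multiplying the expansion for \<open>n\<close> by \<open>x\<close> and by \<open>y\<close> gives two sums. Once the second is
  extended by the vanishing term \<open>n choose Suc n\<close> and its term without \<open>x\<close> is split off, both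
  run over the same monomials, and Pascal's rule adds the coefficients.
\<close>
lemma (in cring) binomial_theorem:
  assumes x: "x \<in> carrier R" and y: "y \<in> carrier R"
  shows "(x \<oplus> y) [^] n = (\<Oplus>k\<in>{..n}. [(n choose k)] \<cdot> (x [^] k \<otimes> y [^] (n - k)))"
proof (induction n)
  case 0
  show ?case using x y by simp
next
  case (Suc n)
  note C [simp] = x y
  let ?t = "\<lambda>n k. [(n choose k)] \<cdot> (x [^] k \<otimes> y [^] (n - k))"
  let ?A = "\<Oplus>k\<in>{..n}. [(n choose k)] \<cdot> (x [^] Suc k \<otimes> y [^] (n - k))"
  let ?B = "\<Oplus>k\<in>{..n}. [(n choose Suc k)] \<cdot> (x [^] Suc k \<otimes> y [^] (n - k))"
  have 1: "(\<Oplus>k\<in>{..n}. ?t n k) \<otimes> x = ?A"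
    by (subst finsum_ldistr) (auto intro!: finsum_cong' simp: add_pow_ldistr add_pow_rdistr m_ac)
  have "(\<Oplus>k\<in>{..n}. ?t n k) \<otimes> y = (\<Oplus>k\<in>{..n}. [(n choose k)] \<cdot> (x [^] k \<otimes> y [^] (Suc n - k)))"
    by (subst finsum_ldistr) (auto intro!: finsum_cong' simp: add_pow_ldistr m_assoc Suc_diff_le)
  also have "\<dots> = (\<Oplus>k\<in>{..Suc n}. [(n choose k)] \<cdot> (x [^] k \<otimes> y [^] (Suc n - k)))"
    by (subst finsum_Suc) (auto simp: binomial_eq_0)
  also have "\<dots> = ?B \<oplus> y [^] Suc n"
    by (subst finsum_Suc2) auto
  finally have 2: "(\<Oplus>k\<in>{..n}. ?t n k) \<otimes> y = ?B \<oplus> y [^] Suc n" .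
  have "(x \<oplus> y) [^] Suc n = ?A \<oplus> (?B \<oplus> y [^] Suc n)"
    by (simp only: nat_pow_Suc Suc.IH) (subst r_distr, auto simp: 1 2)
  also have "\<dots> = (?A \<oplus> ?B) \<oplus> y [^] Suc n"
    by (subst a_assoc) auto
  also have "?A \<oplus> ?B = (\<Oplus>k\<in>{..n}. [(Suc n choose Suc k)] \<cdot> (x [^] Suc k \<otimes> y [^] (n - k)))"
    by (subst finsum_addf[symmetric]) (auto intro!: finsum_cong' simp: add.nat_pow_mult)
  also have "\<dots> \<oplus> y [^] Suc n = (\<Oplus>k\<in>{..Suc n}. ?t (Suc n) k)"
    by (subst finsum_Suc2) auto
  finally show ?case .
qed

text \<open>
  The hypothesis \<open>[p] \<cdot> \<one> = \<zero>\<close> expresses that the characteristic divides \<open>p\<close>.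
\<close>
lemma (in cring) add_pow_eq_zero:
  assumes "[p] \<cdot> \<one> = \<zero>" "p dvd n" "x \<in> carrier R"
  shows "[(n::nat)] \<cdot> x = \<zero>"
proof -
  obtain m where n: "n = p * m" using assms(2) by (rule dvdE)
  have "[p] \<cdot> x = ([p] \<cdot> \<one>) \<otimes> x" using assms(3) by (simp add: add_pow_ldistr)
  then have "[p] \<cdot> x = \<zero>" using assms by simp
  then show ?thesis using assms(3) by (simp add: n flip: add.nat_pow_pow)
qed

text \<open>
  A prime \<open>p\<close> divides the binomial coefficients \<open>p choose k\<close> with \<open>0 < k < p\<close>, so only
  the two extreme terms of the binomial expansion survive.
\<close>
lemma (in cring) frobenius_add:
  assumes p: "Factorial_Ring.prime (p::nat)" "[p] \<cdot> \<one> = \<zero>" and [simp]: "x \<in> carrier R" "y \<in> carrier R"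
  shows "(x \<oplus> y) [^] p = x [^] p \<oplus> y [^] p"
proof -
  obtain m where m: "p = Suc (Suc m)" using prime_ge_2_nat[OF p(1)] by (metis add_2_eq_Suc le_Suc_ex)
  let ?t = "\<lambda>k. [(p choose k)] \<cdot> (x [^] k \<otimes> y [^] (p - k))"
  have "(x \<oplus> y) [^] p = (\<Oplus>k\<in>{..Suc (Suc m)}. ?t k)" by (simp add: binomial_theorem flip: m)
  also have "\<dots> = ?t p \<oplus> ((\<Oplus>k\<in>{..m}. ?t (Suc k)) \<oplus> ?t 0)"
    by (subst finsum_Suc, simp, subst finsum_Suc2) (auto simp: m)
  also have "(\<Oplus>k\<in>{..m}. ?t (Suc k)) = (\<Oplus>k\<in>{..m}. \<zero>)"
    using p(1) m by (intro finsum_cong') (auto intro!: add_pow_eq_zero[OF p(2)] dvd_choose_prime simp del: binomial_Suc_Suc)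
  finally show ?thesis by simp
qed

lemma (in cring) frobenius_power_add:
  assumes p: "Factorial_Ring.prime (p::nat)" "[p] \<cdot> \<one> = \<zero>" and [simp]: "x \<in> carrier R" "y \<in> carrier R"
  shows "(x \<oplus> y) [^] (p ^ n) = x [^] (p ^ n) \<oplus> y [^] (p ^ n)"
proof (induction n)
  case (Suc n)
  have "z [^] (p ^ Suc n) = (z [^] (p ^ n)) [^] p" if "z \<in> carrier R" for z
    using that by (simp add: nat_pow_pow mult.commute[of p])
  then show ?case using Suc frobenius_add[OF p] by simp
qed simp

text \<open>
  The cofactor \<open>g\<close> is \<open>x [^] n \<oplus> x [^] (n - 1) \<otimes> a \<oplus> \<dots> \<oplus> a [^] n\<close>. The homomorphism \<open>h\<close>
  identifies \<open>x\<close> with \<open>a\<close>, so it sends all \<open>n + 1\<close> terms to the same power. For \<open>h\<close> the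
  evaluation of polynomials at \<open>a\<close>, the value of \<open>h g\<close> is the derivative of the power
  function at \<open>a\<close>.
\<close>
lemma (in ring_hom_cring) pow_minus_pow_factor:
  assumes x: "x \<in> carrier R" and a: "a \<in> carrier R" and h: "h x = h a"
  shows "\<exists>g\<in>carrier R. x [^] Suc n \<ominus> a [^] Suc n = (x \<ominus> a) \<otimes> g
    \<and> h g = [Suc n] \<cdot>\<^bsub>S\<^esub> (h a [^]\<^bsub>S\<^esub> n)"
proof (induction n)
  case 0
  show ?case using x a by (intro bexI[of _ \<one>]) auto
next
  case (Suc n)
  then obtain g where g: "g \<in> carrier R" "x [^] Suc n \<ominus> a [^] Suc n = (x \<ominus> a) \<otimes> g"
    "h g = [Suc n] \<cdot>\<^bsub>S\<^esub> (h a [^]\<^bsub>S\<^esub> n)" by blast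
  let ?g = "x \<otimes> g \<oplus> a [^] Suc n"
  have *: "x \<otimes> u \<ominus> a \<otimes> v = (x \<ominus> a) \<otimes> (x \<otimes> g \<oplus> v)"
    if "u \<in> carrier R" "v \<in> carrier R" "u \<ominus> v = (x \<ominus> a) \<otimes> g" for u v
  proof -
    have "x \<otimes> u \<ominus> a \<otimes> v = x \<otimes> (u \<ominus> v) \<oplus> (x \<ominus> a) \<otimes> v"
      using that(1,2) x a by algebra
    also have "\<dots> = (x \<ominus> a) \<otimes> (x \<otimes> g \<oplus> v)"
      unfolding that(3) using that(1,2) x a g(1) by algebra
    finally show ?thesis .
  qed
  have "x [^] Suc (Suc n) \<ominus> a [^] Suc (Suc n) = x \<otimes> x [^] Suc n \<ominus> a \<otimes> a [^] Suc n"
    using x a by (simp only: R.nat_pow_Suc2)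
  also have "\<dots> = (x \<ominus> a) \<otimes> ?g" using x a g by (intro *) auto
  finally have "x [^] Suc (Suc n) \<ominus> a [^] Suc (Suc n) = (x \<ominus> a) \<otimes> ?g" .
  moreover have "h ?g = [Suc (Suc n)] \<cdot>\<^bsub>S\<^esub> (h a [^]\<^bsub>S\<^esub> Suc n)"
  proof -
    have "h ?g = h a \<otimes>\<^bsub>S\<^esub> ([Suc n] \<cdot>\<^bsub>S\<^esub> (h a [^]\<^bsub>S\<^esub> n)) \<oplus>\<^bsub>S\<^esub> h a [^]\<^bsub>S\<^esub> Suc n"
      using x a g(1) h g(3) by (simp del: nat_pow_Suc add.nat_pow_Suc R.nat_pow_Suc S.nat_pow_Suc S.add.nat_pow_Suc)
    also have "h a \<otimes>\<^bsub>S\<^esub> ([Suc n] \<cdot>\<^bsub>S\<^esub> (h a [^]\<^bsub>S\<^esub> n)) = [Suc n] \<cdot>\<^bsub>S\<^esub> (h a [^]\<^bsub>S\<^esub> Suc n)"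
      using a by (subst S.add_pow_rdistr) (auto simp: S.m_comm simp del: S.add.nat_pow_Suc)
    finally show ?thesis by (simp only: S.add.nat_pow_Suc)
  qed
  ultimately show ?case using x a g(1) by (intro bexI[of _ ?g]) auto
qed

text \<open>
  The candidate for a field with \<open>Q\<close> elements: in a field containing \<open>GF(Q)\<close>, the roots
  of \<open>X [^] Q \<ominus> X\<close> are exactly the elements of \<open>GF(Q)\<close>.
\<close>
definition (in ring) frobenius_fixed :: "nat \<Rightarrow> 'a set" where
  "frobenius_fixed Q = {x \<in> carrier R. x [^] Q = x}"

text \<open>
  The map \<open>x \<mapsto> x [^] (p ^ n)\<close> respects products and, in characteristic \<open>p\<close>, also sums, so
  the elements it fixes are closed under all field operations.
\<close>
lemma (in field) frobenius_fixed_subfield: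
  assumes p: "Factorial_Ring.prime (p::nat)" "[p] \<cdot> \<one> = \<zero>"
  shows "subfield (frobenius_fixed (p ^ n)) R"
proof (rule subfieldI')
  have pos: "p ^ n \<noteq> 0" using p(1) by auto
  have F: "(x \<oplus> y) [^] (p ^ n) = x [^] (p ^ n) \<oplus> y [^] (p ^ n)"
    if "x \<in> carrier R" "y \<in> carrier R" for x y
    using that by (rule frobenius_power_add[OF p])
  show "subring (frobenius_fixed (p ^ n)) R"
  proof (rule subringI)
    fix x assume "x \<in> frobenius_fixed (p ^ n)"
    then have x: "x \<in> carrier R" "x [^] (p ^ n) = x" by (auto simp: frobenius_fixed_def)
    have "\<zero> = (x \<oplus> \<ominus> x) [^] (p ^ n)" using x pos by (simp add: r_neg nat_pow_zero)
    also have "\<dots> = x \<oplus> (\<ominus> x) [^] (p ^ n)" using x by (subst F) auto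
    finally have "(\<ominus> x) [^] (p ^ n) = \<ominus> x" using x(1)
      by (metis a_comm a_inv_closed minus_equality nat_pow_closed)
    then show "\<ominus> x \<in> frobenius_fixed (p ^ n)" using x by (simp add: frobenius_fixed_def)
  qed (use F in \<open>auto simp: frobenius_fixed_def nat_pow_distrib\<close>)
  fix x assume "x \<in> frobenius_fixed (p ^ n) - {\<zero>}"
  then have x: "x \<in> carrier R" "x \<noteq> \<zero>" "x [^] (p ^ n) = x" by (auto simp: frobenius_fixed_def)
  then have i: "inv x \<in> carrier R" "x \<otimes> inv x = \<one>" by (auto simp: field_Units)
  have "x \<otimes> (inv x) [^] (p ^ n) = x [^] (p ^ n) \<otimes> (inv x) [^] (p ^ n)" using x by simp
  also have "\<dots> = (x \<otimes> inv x) [^] (p ^ n)" using x(1) i(1)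
    by (rule nat_pow_distrib[symmetric])
  also have "\<dots> = x \<otimes> inv x" by (simp add: i(2))
  finally show "inv x \<in> frobenius_fixed (p ^ n)"
    using x i m_lcancel[of x "inv x [^] (p ^ n)" "inv x"] by (simp add: frobenius_fixed_def)
qed

text \<open>
  The polynomial \<open>f = X [^] Q \<ominus> X\<close> splits, so it has \<open>Q\<close> roots with multiplicity, and all
  of them are simple: for a root \<open>a\<close>, subtracting \<open>a [^] Q \<ominus> a = \<zero>\<close> gives
  \<open>f = (X [^] Q \<ominus> a [^] Q) \<ominus> (X \<ominus> a) = (X \<ominus> a) \<otimes> (g \<ominus> \<one>)\<close>, where \<open>g\<close> takes the value
  \<open>Q \<cdot> a [^] (Q - 1) = \<zero>\<close> at \<open>a\<close>. So the second factor has the value \<open>\<ominus> \<one>\<close> there.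
\<close>
lemma (in algebraically_closed) card_frobenius_fixed:
  assumes Q: "Q \<ge> 2" "[Q] \<cdot> \<one> = \<zero>"
  shows "card (frobenius_fixed Q) = Q"
proof -
  let ?P = "poly_ring L"
  interpret P: domain ?P by (rule univ_poly_is_domain[OF carrier_is_subring])
  have X: "X \<in> carrier ?P" by (rule var_closed(1)[OF carrier_is_subring])
  define f where "f = X [^]\<^bsub>?P\<^esub> Q \<ominus>\<^bsub>?P\<^esub> X"
  have f: "f \<in> carrier ?P" using X by (simp add: f_def)
  have degX: "degree X = 1" by (simp add: var_def)
  have degXQ: "degree (X [^]\<^bsub>?P\<^esub> Q) = Q"
    unfolding unitary_monom_eq_var_pow[OF carrier_is_subring, symmetric] by (simp add: monom_def)
  have degf: "degree f = Q"
  proof -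
    have "degree f = degree (poly_add (X [^]\<^bsub>?P\<^esub> Q) (\<ominus>\<^bsub>?P\<^esub> X))"
      by (simp add: f_def a_minus_def univ_poly_add)
    also have "\<dots> = max Q 1"
      using Q X degX degXQ univ_poly_a_inv_degree[OF carrier_is_subring X]
      by (subst poly_add_degree_eq[OF carrier_is_subring]) (auto simp: univ_poly_carrier)
    finally show ?thesis using Q by simp
  qed
  have f0: "f \<noteq> []" using degf Q by auto
  have eval: "eval f a = a [^] Q \<ominus> a" if a: "a \<in> carrier L" for a
  proof -
    interpret h: ring_hom_cring ?P L "\<lambda>p. eval p a" by (rule eval_cring_hom[OF carrier_is_subring a])
    show ?thesis using X a by (simp add: f_def a_minus_def eval_var)
  qed
  have roots: "set_mset (roots f) = frobenius_fixed Q"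
    by (auto simp: roots_mem_iff_is_root[OF f] is_root_def f0 eval frobenius_fixed_def)
  have simple: "count (roots f) a \<le> 1" for a
  proof (rule ccontr)
    assume "\<not> count (roots f) a \<le> 1"
    then have mult: "2 \<le> alg_mult f a" and "a \<in># roots f"
      by (auto simp: alg_mult_eq_count_roots[OF f] not_le count_inI simp flip: count_greater_zero_iff)
    then have a: "a \<in> carrier L" "a [^] Q = a" by (auto simp: roots frobenius_fixed_def)
    interpret h: ring_hom_cring ?P L "\<lambda>p. eval p a" by (rule eval_cring_hom[OF carrier_is_subring a(1)])
    \<comment> \<open>The constant polynomial \<open>c\<close> stands for the root \<open>a\<close> inside the polynomial ring.\<close>
    define c where "c = poly_of_const a"
    interpret const: ring_hom_cring L ?P poly_of_const
      using canonical_embedding_is_hom[OF carrier_is_subring] by unfold_locales simp_all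
    have c: "c \<in> carrier ?P" "eval c a = a"
      using a(1) eval_normalize[of "[a]" a]
      by (simp_all add: c_def) (simp add: poly_of_const_def)
    let ?d = "X \<ominus>\<^bsub>?P\<^esub> c"
    have "?d = poly_add X (poly_of_const (\<ominus> a))"
      using a(1) by (simp add: c_def a_minus_def univ_poly_add)
    then have d: "?d = [\<one>, \<ominus> a]" using a(1) by (simp add: var_def poly_of_const_def)
    have d0: "?d \<noteq> \<zero>\<^bsub>?P\<^esub>" by (simp add: d univ_poly_zero)
    have evd: "eval ?d a = \<zero>" using a by (simp add: d r_neg)
    obtain n where n: "Q = Suc n" using Q by (cases Q) auto
    obtain g where g: "g \<in> carrier ?P" "X [^]\<^bsub>?P\<^esub> Q \<ominus>\<^bsub>?P\<^esub> c [^]\<^bsub>?P\<^esub> Q = ?d \<otimes>\<^bsub>?P\<^esub> g"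
      "eval g a = [Q] \<cdot> (a [^] n)"
      using h.pow_minus_pow_factor[OF X c(1), of n] c a by (auto simp: eval_var n)
    have g0: "eval g a = \<zero>" using g(3) add_pow_eq_zero[OF Q(2), of Q] a by simp
    have cQ: "c [^]\<^bsub>?P\<^esub> Q = c"
      using a by (simp add: c_def flip: const.hom_pow)
    have "f = (X [^]\<^bsub>?P\<^esub> Q \<ominus>\<^bsub>?P\<^esub> c [^]\<^bsub>?P\<^esub> Q) \<ominus>\<^bsub>?P\<^esub> ?d"
    proof -
      have *: "u \<ominus>\<^bsub>?P\<^esub> X = (u \<ominus>\<^bsub>?P\<^esub> c) \<ominus>\<^bsub>?P\<^esub> ?d" if "u \<in> carrier ?P" for u
        using that X c(1) by algebra
      show ?thesis unfolding cQ f_def by (rule *) (use X in simp)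
    qed
    also have "\<dots> = ?d \<otimes>\<^bsub>?P\<^esub> (g \<ominus>\<^bsub>?P\<^esub> \<one>\<^bsub>?P\<^esub>)"
      unfolding g(2) using g(1) X c(1) by algebra
    finally have f_eq: "f = ?d \<otimes>\<^bsub>?P\<^esub> (g \<ominus>\<^bsub>?P\<^esub> \<one>\<^bsub>?P\<^esub>)" .
    \<comment> \<open>A double root would make \<open>X \<ominus> a\<close> divide \<open>g \<ominus> \<one>\<close> as well.\<close>
    have "(?d [^]\<^bsub>?P\<^esub> (2::nat)) pdivides f"
      using le_alg_mult_imp_pdivides[OF a(1) f mult] by (simp add: d)
    then obtain r where r: "r \<in> carrier ?P" "f = ?d [^]\<^bsub>?P\<^esub> (2::nat) \<otimes>\<^bsub>?P\<^esub> r"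
      by (auto simp: pdivides_def factor_def)
    have "?d \<otimes>\<^bsub>?P\<^esub> (g \<ominus>\<^bsub>?P\<^esub> \<one>\<^bsub>?P\<^esub>) = ?d \<otimes>\<^bsub>?P\<^esub> (?d \<otimes>\<^bsub>?P\<^esub> r)"
    proof -
      have "?d [^]\<^bsub>?P\<^esub> (2::nat) = ?d \<otimes>\<^bsub>?P\<^esub> ?d"
        using X c(1) by (simp only: numeral_2_eq_2 P.nat_pow_Suc P.nat_pow_0 P.l_one P.minus_closed)
      then show ?thesis
        using f_eq r X c(1) by (simp only: P.m_assoc P.minus_closed)
    qed
    then have "g \<ominus>\<^bsub>?P\<^esub> \<one>\<^bsub>?P\<^esub> = ?d \<otimes>\<^bsub>?P\<^esub> r"
      by (rule P.m_lcancel[OF d0, THEN iffD1, rotated -1]) (use X c(1) g(1) r(1) in simp_all)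
    then have "eval (g \<ominus>\<^bsub>?P\<^esub> \<one>\<^bsub>?P\<^esub>) a = \<zero>"
      using h.hom_mult[of ?d r] h.hom_closed[OF r(1)] X c(1) r(1) by (simp only: evd P.minus_closed l_null)
    moreover have "eval (g \<ominus>\<^bsub>?P\<^esub> \<one>\<^bsub>?P\<^esub>) a = \<ominus> \<one>"
      using g(1) g0 by (simp add: a_minus_def)
    ultimately have "\<ominus> (\<ominus> \<one>) = \<zero>" by simp
    then show False by simp
  qed
  have "Q = size (roots f)" using roots_over_carrier[OF f] degf by (simp add: splitted_def)
  also have "\<dots> = (\<Sum>a\<in>set_mset (roots f). 1)"
    unfolding size_multiset_overloaded_eq
  proof (rule sum.cong[OF refl])
    fix a assume "a \<in> set_mset (roots f)"
    then have "count (roots f) a > 0" by simp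
    then show "count (roots f) a = 1" using simple[of a] by linarith
  qed
  finally show ?thesis by (simp add: roots)
qed

text \<open>
  Let \<open>A\<close> be an algebraic closure of the integers modulo \<open>p\<close>, where \<open>q = p ^ k\<close>. The fixed
  elements of the \<open>q\<^sup>2\<close>-th power map on \<open>A\<close> form a field with \<open>q\<^sup>2\<close> elements, which contains
  the \<open>q\<close> fixed elements of the \<open>q\<close>-th power map. The type of \<open>L\<close> is that of the elements of
  the algebraic closure.
\<close>
lemma exists_quadratic_extension:
  assumes "primepow q"
  obtains L :: "((int list \<times> nat) multiset \<Rightarrow> int) ring" and K c
  where "field L" "order L = q\<^sup>2" "subfield K L" "card K = q" "c \<in> carrier L - K"
proof -
  from assms obtain p k where p: "Factorial_Ring.prime (p::nat)" and k: "k > 0" and q: "q = p ^ k"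
    by (auto simp: primepow_def)
  interpret R: residues_prime p "residue_ring (int p)"
    by unfold_locales (use p in auto)
  obtain A :: "((int list \<times> nat) multiset \<Rightarrow> int) ring" where
    A: "algebraic_closure A (R.indexed_const ` carrier (residue_ring (int p)))" and
    hom: "R.indexed_const \<in> ring_hom (residue_ring (int p)) A"
    by (rule R.exists_closure)
  interpret A: algebraic_closure A "R.indexed_const ` carrier (residue_ring (int p))" by (rule A)
  interpret h: ring_hom_ring "residue_ring (int p)" A R.indexed_const
    by (rule ring_hom_ringI2[OF R.ring_axioms A.ring_axioms hom])
  \<comment> \<open>The closure inherits the characteristic \<open>p\<close> along the embedding of the prime field.\<close>
  have "[n] \<cdot>\<^bsub>A\<^esub> \<one>\<^bsub>A\<^esub> = R.indexed_const (int n mod int p)" for n :: nat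
  proof (induction n)
    case 0
    show ?case using h.hom_zero by (simp add: R.res_zero_eq)
  next
    case (Suc n)
    have "R.indexed_const (int (Suc n) mod int p) =
        R.indexed_const ((int n mod int p) \<oplus>\<^bsub>residue_ring (int p)\<^esub> \<one>\<^bsub>residue_ring (int p)\<^esub>)"
      by (simp add: R.res_add_eq R.res_one_eq mod_simps add.commute)
    also have "\<dots> = R.indexed_const (int n mod int p) \<oplus>\<^bsub>A\<^esub> \<one>\<^bsub>A\<^esub>"
      by (subst h.hom_add) auto
    finally show ?case using Suc by simp
  qed
  from this[of p] have char: "[p] \<cdot>\<^bsub>A\<^esub> \<one>\<^bsub>A\<^esub> = \<zero>\<^bsub>A\<^esub>"
    using h.hom_zero by (simp add: R.res_zero_eq)
  have card: "card (A.frobenius_fixed (p ^ n)) = p ^ n" if "n > 0" for n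
  proof (rule A.card_frobenius_fixed)
    show "[(p ^ n)] \<cdot>\<^bsub>A\<^esub> \<one>\<^bsub>A\<^esub> = \<zero>\<^bsub>A\<^esub>"
      using that by (intro A.add_pow_eq_zero[OF char]) auto
    show "2 \<le> p ^ n"
      using that prime_ge_2_nat[OF p] self_le_power[of p n] by linarith
  qed
  let ?K = "A.frobenius_fixed (p ^ k)" and ?E = "A.frobenius_fixed (p ^ (2 * k))"
  let ?L = "A\<lparr>carrier := ?E\<rparr>"
  have L: "field ?L" using A.frobenius_fixed_subfield[OF p char] by (rule A.subfield_iff(2))
  have sub: "?K \<subseteq> ?E"
  proof
    fix x assume "x \<in> ?K"
    then have x: "x \<in> carrier A" "x [^]\<^bsub>A\<^esub> (p ^ k) = x" by (auto simp: A.frobenius_fixed_def)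
    have "x [^]\<^bsub>A\<^esub> (p ^ (2 * k)) = (x [^]\<^bsub>A\<^esub> (p ^ k)) [^]\<^bsub>A\<^esub> (p ^ k)"
      using x(1) by (simp add: A.nat_pow_pow mult_2 power_add)
    then show "x \<in> ?E" using x by (simp add: A.frobenius_fixed_def)
  qed
  interpret L: field ?L by (rule L)
  have K: "subfield ?K ?L"
    using A.subfield_iff(2)[OF A.frobenius_fixed_subfield[OF p char], of k] sub
    by (intro L.subfield_iff(1)) simp_all
  have cards: "card ?K = q" "card ?E = q\<^sup>2"
    using card[of k] card[of "2 * k"] k by (simp_all add: q power_mult mult.commute[of 2 k])
  have "q > 1" using primepow_gt_Suc_0[OF assms] by simp
  then have "q < q\<^sup>2" by (simp add: power2_eq_square)
  then have "?K \<noteq> ?E" using cards by (metis less_irrefl)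
  then obtain c where "c \<in> ?E - ?K" using sub by blast
  then have c: "c \<in> carrier ?L - ?K" by simp
  have "order ?L = q\<^sup>2" using cards(2) by (simp add: order_def)
  from that[OF L this K cards(1) c] show ?thesis .
qed

section \<open>The lower bound\<close>

theorem theorem6p4:
  fixes q :: nat
  assumes "primepow q"
  shows "(\<forall>(F :: ('a, 'b) ring_scheme) K c.
            field F \<and> order F = q^2 \<and> subfield K F \<and> card K = q \<and> c \<in> carrier F - K \<longrightarrow>
            division_sudoku q (carrier F) (DS F c) \<and>
            sigma q (carrier F) (DS F c) \<ge> q + 1)
         \<and> sigma_max q \<ge> q + 1"
proof (intro conjI allI impI)
  fix F :: "('a, 'b) ring_scheme" and K c
  assume "field F \<and> order F = q^2 \<and> subfield K F \<and> card K = q \<and> c \<in> carrier F - K"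
  then have F: "field F" "order F = q\<^sup>2" "subfield K F" "card K = q" "c \<in> carrier F - K"
    by blast+
  show "division_sudoku q (carrier F) (DS F c)" "sigma q (carrier F) (DS F c) \<ge> q + 1"
    using division_sudoku_DS_of_order[OF assms F] .
next
  obtain L :: "((int list \<times> nat) multiset \<Rightarrow> int) ring" and K c where
    L: "field L" "order L = q\<^sup>2" "subfield K L" "card K = q" "c \<in> carrier L - K"
    by (rule exists_quadratic_extension[OF assms])
  note DS = division_sudoku_DS_of_order[OF assms L]
  show "sigma_max q \<ge> q + 1" using DS(2) sigma_le_sigma_max[OF DS(1)] by (rule le_trans)
qed

end
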